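(* Let $A^\ast_{n,\le m}$, $A^\ast_{n,\ge m}$, $\xi_n$, $\alpha_j$ be taken from any one of the four families (Bernoulli, Cauchy, Euler, Euler of the second kind) described in the context, with the corresponding integer parameter $N$. For $n\ge m\ge 1$, we have $$A_{n,\le m}^\ast=(-1)^n\xi_n\sum_{t_1+2t_2+\cdots+mt_m=n}\binom{t_1+\cdots+t_m}{t_1,\dots,t_m}(-1)^{t_1+\cdots+t_m}\alpha_1^{t_1}\cdots\alpha_m^{t_m}$$ and $$A_{n,\ge m}^\ast=(-1)^n\xi_n\sum_{mt_m+(m+1)t_{m+1}+\cdots+nt_n=n}\binom{t_m+t_{m+1}+\cdots+t_n}{t_m,t_{m+1},\dots,t_n}(-1)^{t_m+t_{m+1}+\cdots+t_n}\alpha_m^{t_m}\alpha_{m+1}^{t_{m+1}}\cdots\alpha_n^{t_n},$$ where the sums run over tuples of nonnegative integers $(t_1,\dots,t_m)$, respectively $(t_m,\dots,t_n)$.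
   Context: $(x)^{(n)}=x(x+1)\cdots(x+n-1)$ for $n\ge1$ and $(x)^{(0)}=1$ (rising factorial). $\binom{t_1+\cdots+t_r}{t_1,\dots,t_r}=\frac{(t_1+\cdots+t_r)!}{t_1!\cdots t_r!}$. All identities below are between formal power series in $x$. For an integer $m\ge 1$ define the modified restricted and modified associated hypergeometric numbers by: - Bernoulli ($N\ge1$): $\left(\sum_{n=0}^{m}\frac{x^n}{(N+1)^{(n)}}\right)^{-1}=\sum_{n=0}^\infty B_{N,n,\le m}^\ast\frac{x^n}{n!}$ and $\left(1+\sum_{n=m}^{\infty}\frac{x^n}{(N+1)^{(n)}}\right)^{-1}=\sum_{n=0}^\infty B_{N,n,\ge m}^\ast\frac{x^n}{n!}$; - Cauchy ($N\ge1$): $\left(N\sum_{n=0}^{m}\frac{(-x)^n}{N+n}\right)^{-1}=\sum_{n=0}^\infty c_{N,n,\le m}^\ast\frac{x^n}{n!}$ and $\left(1+N\sum_{n=m}^{\infty}\frac{(-x)^n}{N+n}\right)^{-1}=\sum_{n=0}^\infty c_{N,n,\ge m}^\ast\frac{x^n}{n!}$; - Euler ($N\ge0$): $\left(\sum_{n=0}^{m}\frac{x^{2n}}{(2N+1)^{(2n)}}\right)^{-1}=\sum_{n=0}^\infty E_{N,n,\le m}^\ast\frac{x^n}{n!}$ and $\left(1+\sum_{n=m}^{\infty}\frac{x^{2n}}{(2N+1)^{(2n)}}\right)^{-1}=\sum_{n=0}^\infty E_{N,n,\ge m}^\ast\frac{x^n}{n!}$; - Euler of the second kind ($N\ge0$):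 $\left(\sum_{n=0}^{m}\frac{x^{2n}}{(2N+2)^{(2n)}}\right)^{-1}=\sum_{n=0}^\infty\widehat E_{N,n,\le m}^\ast\frac{x^n}{n!}$ and $\left(1+\sum_{n=m}^{\infty}\frac{x^{2n}}{(2N+2)^{(2n)}}\right)^{-1}=\sum_{n=0}^\infty\widehat E_{N,n,\ge m}^\ast\frac{x^n}{n!}$. The symbols $A^\ast_{n,\le m}$, $A^\ast_{n,\ge m}$, $\xi_n$ ($n\ge0$), $\alpha_j$ ($j\ge1$) denote simultaneously one of the following choices ($N$ is suppressed from the notation): - Bernoulli: $A^\ast_{n,\le m}=B^\ast_{N,n,\le m}$, $A^\ast_{n,\ge m}=B^\ast_{N,n,\ge m}$, $\xi_n=(-1)^n n!$, $\alpha_j=\frac{N!}{(N+j)!}$, $N\ge1$; - Cauchy: $A^\ast_{n,\le m}=c^\ast_{N,n,\le m}$, $A^\ast_{n,\ge m}=c^\ast_{N,n,\ge m}$, $\xi_n=n!$, $\alpha_j=\frac{N}{N+j}$, $N\ge1$; - Euler: $A^\ast_{n,\le m}=E^\ast_{N,2n,\le m}$, $A^\ast_{n,\ge m}=E^\ast_{N,2n,\ge m}$, $\xi_n=(-1)^n(2n)!$, $\alpha_j=\frac{(2N)!}{(2N+2j)!}$, $N\ge0$; - Euler of the second kind: $A^\ast_{n,\le m}=\widehat E^\ast_{N,2n,\le m}$, $A^\ast_{n,\ge m}=\widehat E^\ast_{N,2n,\ge m}$, $\xi_n=(-1)^n(2n)!$, $\alpha_j=\frac{(2N+1)!}{(2N+2j+1)!}$,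 $N\ge0$. *)

theory Defs
  imports "HOL-Computational_Algebra.Formal_Power_Series" "HOL-Library.FuncSet"
begin

text \<open>All the numbers involved are rational, so power series are taken over \<^typ>\<open>rat\<close>.
  The rising factorial is the library's \<^const>\<open>pochhammer\<close>.  In each series below the
  constant coefficient is 1, provided that \<open>m \<ge> 1\<close> and, for Cauchy, \<open>N \<ge> 1\<close>, so that
  \<^const>\<open>inverse\<close> is the reciprocal power series.\<close>

text \<open>The numbers \<open>a n\<close> with \<open>f = (\<Sum>n. a n * x ^ n / n!)\<close>.\<close>

definition egf_coeff :: "rat fps \<Rightarrow> nat \<Rightarrow> rat" where
  "egf_coeff f n = fact n * fps_nth f n"

text \<open>The series \<open>\<Sum>n\<ge>m. a n * x ^ n\<close>.\<close>

definition fps_from :: "nat \<Rightarrow> (nat \<Rightarrow> rat) \<Rightarrow> rat fps" where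
  "fps_from m a = Abs_fps (\<lambda>n. if m \<le> n then a n else 0)"

text \<open>The suffixes \<open>_le\<close> and \<open>_ge\<close> mark the modified restricted and the modified associated
  numbers; \<open>euler2\<close> stands for the Euler numbers of the second kind.\<close>

definition bernoulli_le :: "nat \<Rightarrow> nat \<Rightarrow> nat \<Rightarrow> rat" where
  "bernoulli_le N m = egf_coeff (inverse
     (\<Sum>n=0..m. fps_const (1 / pochhammer (of_nat N + 1) n) * fps_X ^ n))"

definition bernoulli_ge :: "nat \<Rightarrow> nat \<Rightarrow> nat \<Rightarrow> rat" where
  "bernoulli_ge N m = egf_coeff (inverse
     (1 + fps_from m (\<lambda>n. 1 / pochhammer (of_nat N + 1) n)))"

definition cauchy_le :: "nat \<Rightarrow> nat \<Rightarrow> nat \<Rightarrow> rat" where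
  "cauchy_le N m = egf_coeff (inverse
     (of_nat N * (\<Sum>n=0..m. fps_const (1 / (of_nat N + of_nat n)) * (- fps_X) ^ n)))"

definition cauchy_ge :: "nat \<Rightarrow> nat \<Rightarrow> nat \<Rightarrow> rat" where
  "cauchy_ge N m = egf_coeff (inverse
     (1 + of_nat N * fps_from m (\<lambda>n. (- 1) ^ n / (of_nat N + of_nat n))))"

text \<open>Series in \<open>x\<^sup>2\<close> starting at \<open>n = m\<close> are obtained by substituting \<open>x\<^sup>2\<close> for \<open>x\<close>.\<close>

definition euler_le :: "nat \<Rightarrow> nat \<Rightarrow> nat \<Rightarrow> rat" where
  "euler_le N m = egf_coeff (inverse
     (\<Sum>n=0..m. fps_const (1 / pochhammer (2 * of_nat N + 1) (2 * n)) * fps_X ^ (2 * n)))"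

definition euler_ge :: "nat \<Rightarrow> nat \<Rightarrow> nat \<Rightarrow> rat" where
  "euler_ge N m = egf_coeff (inverse
     (1 + (fps_from m (\<lambda>n. 1 / pochhammer (2 * of_nat N + 1) (2 * n)) oo fps_X ^ 2)))"

definition euler2_le :: "nat \<Rightarrow> nat \<Rightarrow> nat \<Rightarrow> rat" where
  "euler2_le N m = egf_coeff (inverse
     (\<Sum>n=0..m. fps_const (1 / pochhammer (2 * of_nat N + 2) (2 * n)) * fps_X ^ (2 * n)))"

definition euler2_ge :: "nat \<Rightarrow> nat \<Rightarrow> nat \<Rightarrow> rat" where
  "euler2_ge N m = egf_coeff (inverse
     (1 + (fps_from m (\<lambda>n. 1 / pochhammer (2 * of_nat N + 2) (2 * n)) oo fps_X ^ 2)))"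

datatype family = Bernoulli_Fam | Cauchy_Fam | Euler_Fam | Euler2_Fam

fun A_le :: "family \<Rightarrow> nat \<Rightarrow> nat \<Rightarrow> nat \<Rightarrow> rat" where
  "A_le Bernoulli_Fam N m n = bernoulli_le N m n"
| "A_le Cauchy_Fam N m n = cauchy_le N m n"
| "A_le Euler_Fam N m n = euler_le N m (2 * n)"
| "A_le Euler2_Fam N m n = euler2_le N m (2 * n)"

fun A_ge :: "family \<Rightarrow> nat \<Rightarrow> nat \<Rightarrow> nat \<Rightarrow> rat" where
  "A_ge Bernoulli_Fam N m n = bernoulli_ge N m n"
| "A_ge Cauchy_Fam N m n = cauchy_ge N m n"
| "A_ge Euler_Fam N m n = euler_ge N m (2 * n)"
| "A_ge Euler2_Fam N m n = euler2_ge N m (2 * n)"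

fun xi :: "family \<Rightarrow> nat \<Rightarrow> rat" where
  "xi Bernoulli_Fam n = (- 1) ^ n * fact n"
| "xi Cauchy_Fam n = fact n"
| "xi Euler_Fam n = (- 1) ^ n * fact (2 * n)"
| "xi Euler2_Fam n = (- 1) ^ n * fact (2 * n)"

fun alpha :: "family \<Rightarrow> nat \<Rightarrow> nat \<Rightarrow> rat" where
  "alpha Bernoulli_Fam N j = fact N / fact (N + j)"
| "alpha Cauchy_Fam N j = of_nat N / (of_nat N + of_nat j)"
| "alpha Euler_Fam N j = fact (2 * N) / fact (2 * N + 2 * j)"
| "alpha Euler2_Fam N j = fact (2 * N + 1) / fact (2 * N + 2 * j + 1)"

definition multinomial :: "nat set \<Rightarrow> (nat \<Rightarrow> nat) \<Rightarrow> rat" where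
  "multinomial J t = fact (\<Sum>j\<in>J. t j) / (\<Prod>j\<in>J. fact (t j))"

text \<open>A tuple \<open>(t\<^sub>j)\<close> indexed by \<open>j \<in> J\<close> is a function that is extensional on \<open>J\<close>, so
  that distinct members of the following set are distinct tuples.\<close>

definition weighted_tuples :: "nat set \<Rightarrow> nat \<Rightarrow> (nat \<Rightarrow> nat) set" where
  "weighted_tuples J n = {t \<in> J \<rightarrow>\<^sub>E UNIV. (\<Sum>j\<in>J. j * t j) = n}"

text \<open>Sums over these sets are genuine, since the sets are finite.\<close>

lemma finite_weighted_tuples:
  assumes "finite J" and "0 \<notin> J"
  shows "finite (weighted_tuples J n)"
proof (rule finite_subset)
  show "weighted_tuples J n \<subseteq> J \<rightarrow>\<^sub>E {..n}"
  proof
    fix t assume t: "t \<in> weighted_tuples J n"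
    have "t j \<le> n" if j: "j \<in> J" for j
    proof -
      have "j \<noteq> 0" using assms(2) j by metis
      then have "t j \<le> j * t j" by simp
      also have "\<dots> \<le> (\<Sum>j\<in>J. j * t j)"
        by (rule member_le_sum) (use assms(1) j in auto)
      also have "\<dots> = n" using t by (simp add: weighted_tuples_def)
      finally show ?thesis .
    qed
    then show "t \<in> J \<rightarrow>\<^sub>E {..n}"
      using t by (auto simp: weighted_tuples_def PiE_iff)
  qed
  show "finite (J \<rightarrow>\<^sub>E {..n})"
    using assms(1) by (intro finite_PiE) auto
qed

end

theory Submission
  imports Defs
begin

text \<open>Each number is, up to a factorial, a coefficient of the reciprocal of a series with
  constant coefficient 1 whose other coefficients are the \<open>\<alpha>\<^sub>j\<close> (for Cauchy,
  \<open>(-1)\<^sup>j \<alpha>\<^sub>j\<close>) with \<open>j\<close> in an index set \<open>J\<close>.  The theorem is therefore an instance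
  of one expansion,

    \<open>1 / (1 - (\<Sum>j\<in>J. b\<^sub>j * x\<^sup>j)) = (\<Sum>n. x\<^sup>n * (\<Sum>t. multinomial t * (\<Prod>j\<in>J. b\<^sub>j ^ t\<^sub>j)))\<close>

  with \<open>b\<^sub>j = -\<alpha>\<^sub>j\<close> (or \<open>-(-1)\<^sup>j \<alpha>\<^sub>j\<close>) and with the inner sum \<open>W n\<close> over the tuples of
  weight \<open>n\<close>.  Combinatorially the right-hand side
  counts, with weights, the sequences of parts from \<open>J\<close> with sum \<open>n\<close>: the multinomial
  coefficient is the number of ways to order \<open>t\<^sub>j\<close> parts of each size \<open>j\<close>.  Deleting the first
  part of such a sequence gives \<open>W n = (\<Sum>j. b\<^sub>j * W (n - j))\<close> for \<open>n > 0\<close>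
  (\<open>tuple_sum_rec\<close>), which is also the recurrence for the coefficients of the reciprocal
  (\<open>fps_nth_inverse_tuple_sum\<close>).  On tuples, deleting a part is the Pascal rule for
  multinomial coefficients (\<open>tuple_term_pascal\<close>).

  The coefficient of \<open>x\<^sup>n\<close> in a reciprocal depends only on the coefficients of the series up to
  \<open>x\<^sup>n\<close>, so that in the associated case the infinite series may be cut off and \<open>J\<close> taken to be
  \<open>{m..n}\<close>.  The Euler series are series in \<open>x\<^sup>2\<close>, and since taking reciprocals commutes with
  substitution, their coefficients at \<open>2 * n\<close> are those of the corresponding series in \<open>x\<close>
  at \<open>n\<close>.\<close>

section \<open>Weighted sums over tuples\<close>

definition tuple_term :: "nat set \<Rightarrow> (nat \<Rightarrow> rat) \<Rightarrow> (nat \<Rightarrow> nat) \<Rightarrow> rat" where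
  "tuple_term J b t = multinomial J t * (\<Prod>j\<in>J. b j ^ t j)"

definition tuple_sum :: "nat set \<Rightarrow> (nat \<Rightarrow> rat) \<Rightarrow> nat \<Rightarrow> rat" where
  "tuple_sum J b n = (\<Sum>t\<in>weighted_tuples J n. tuple_term J b t)"

text \<open>The relation between neighbouring tuples is stated without division and for raising an
  entry, which makes it hold for every value of \<open>u j\<close>.\<close>

lemma tuple_term_raise:
  assumes "finite J" and "j \<in> J"
  shows "of_nat (Suc (u j)) * tuple_term J b (u(j := Suc (u j)))
       = of_nat (Suc (\<Sum>i\<in>J. u i)) * (b j * tuple_term J b u)"
proof -
  have rest: "(\<Sum>i\<in>J - {j}. (u(j := Suc (u j))) i) = (\<Sum>i\<in>J - {j}. u i)"
    "(\<Prod>i\<in>J - {j}. fact ((u(j := Suc (u j))) i)) = (\<Prod>i\<in>J - {j}. fact (u i) :: rat)"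
    "(\<Prod>i\<in>J - {j}. b i ^ (u(j := Suc (u j))) i) = (\<Prod>i\<in>J - {j}. b i ^ u i)"
    by (auto intro!: sum.cong prod.cong)
  have "(\<Sum>i\<in>J. (u(j := Suc (u j))) i) = Suc (\<Sum>i\<in>J. u i)"
    by (simp add: sum.remove[OF assms] rest(1) del: fun_upd_apply) simp
  moreover have "(\<Prod>i\<in>J. fact ((u(j := Suc (u j))) i) :: rat)
      = of_nat (Suc (u j)) * (\<Prod>i\<in>J. fact (u i))"
    unfolding prod.remove[OF assms] rest(2) by simp
  moreover have "(\<Prod>i\<in>J. b i ^ (u(j := Suc (u j))) i) = b j * (\<Prod>i\<in>J. b i ^ u i)"
    unfolding prod.remove[OF assms] rest(3) by simp
  moreover have "(of_nat (Suc (u j)) :: rat) \<noteq> 0"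
    by (rule of_nat_neq_0)
  ultimately show ?thesis
    unfolding tuple_term_def multinomial_def
    by (simp add: field_simps del: of_nat_Suc)
qed

text \<open>The Pascal rule for multinomial coefficients, in weighted form.  A fraction \<open>t\<^sub>j / s\<close> of the
  orderings of \<open>s\<close> parts begins with a part of size \<open>j\<close>; these fractions add up to 1, and
  \<open>tuple_term_raise\<close> identifies each share with the term of the tuple that has one part
  \<open>j\<close> fewer.\<close>

lemma tuple_term_pascal:
  assumes "finite J" and "(\<Sum>i\<in>J. t i) > 0"
  shows "tuple_term J b t
       = (\<Sum>j\<in>{j \<in> J. t j > 0}. b j * tuple_term J b (t(j := t j - 1)))"
proof -
  define s where "s = (\<Sum>i\<in>J. t i)"
  have lower: "of_nat (t j) * tuple_term J b t
      = of_nat s * (b j * tuple_term J b (t(j := t j - 1)))"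
    if j: "j \<in> J" "t j > 0" for j
  proof -
    let ?u = "t(j := t j - 1)"
    have up: "?u(j := Suc (?u j)) = t" and pos: "Suc (?u j) = t j"
      using j by auto
    have "(\<Sum>i\<in>J - {j}. ?u i) = (\<Sum>i\<in>J - {j}. t i)"
      by (intro sum.cong) auto
    then have "Suc (\<Sum>i\<in>J. ?u i) = s"
      unfolding s_def sum.remove[OF assms(1) j(1)] using j(2) by simp
    with tuple_term_raise[OF assms(1) j(1), of ?u b] up pos show ?thesis
      by (simp del: of_nat_Suc fun_upd_apply)
  qed
  have "of_nat s * tuple_term J b t = (\<Sum>j\<in>J. of_nat (t j) * tuple_term J b t)"
    by (simp add: s_def sum_distrib_right)
  also have "\<dots> = (\<Sum>j\<in>{j \<in> J. t j > 0}. of_nat (t j) * tuple_term J b t)"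
    using assms(1) by (intro sum.mono_neutral_right) auto
  also have "\<dots> = (\<Sum>j\<in>{j \<in> J. t j > 0}.
      of_nat s * (b j * tuple_term J b (t(j := t j - 1))))"
    by (intro sum.cong refl lower) auto
  finally have "of_nat s * tuple_term J b t = of_nat s *
      (\<Sum>j\<in>{j \<in> J. t j > 0}. b j * tuple_term J b (t(j := t j - 1)))"
    by (simp add: sum_distrib_left)
  moreover have "(of_nat s :: rat) \<noteq> 0"
    using assms(2) unfolding s_def of_nat_eq_0_iff by (rule gr_implies_not0)
  ultimately show ?thesis
    by simp
qed

lemma weighted_sum_remove:
  fixes t :: "nat \<Rightarrow> nat"
  assumes "finite J" and "j \<in> J" and "t j > 0"
  shows "(\<Sum>i\<in>J. i * (t(j := t j - 1)) i) + j = (\<Sum>i\<in>J. i * t i)"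
proof -
  have "(\<Sum>i\<in>J - {j}. i * (t(j := t j - 1)) i) = (\<Sum>i\<in>J - {j}. i * t i)"
    by (intro sum.cong) auto
  moreover obtain k where "t j = Suc k"
    using assms(3) gr0_implies_Suc by blast
  ultimately show ?thesis
    unfolding sum.remove[OF assms(1,2)] by simp
qed

text \<open>Removing one part of size \<open>j\<close> is a bijection from the tuples of weight \<open>n\<close> that contain such
  a part to all tuples of weight \<open>n - j\<close>.\<close>

lemma tuple_sum_lower:
  assumes "finite J" and "j \<in> J" and "j \<le> n"
  shows "(\<Sum>t\<in>{t \<in> weighted_tuples J n. t j > 0}. tuple_term J b (t(j := t j - 1)))
       = tuple_sum J b (n - j)"
  unfolding tuple_sum_def
proof (rule sum.reindex_bij_witness[where i = "\<lambda>u. u(j := Suc (u j))"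
      and j = "\<lambda>t. t(j := t j - 1)"])
  fix t assume t: "t \<in> {t \<in> weighted_tuples J n. t j > 0}"
  then have "(\<Sum>i\<in>J. i * (t(j := t j - 1)) i) = n - j"
    using weighted_sum_remove[OF assms(1,2), of t] by (simp add: weighted_tuples_def)
  then show "t(j := t j - 1) \<in> weighted_tuples J (n - j)"
    using t assms(2) by (auto simp: weighted_tuples_def PiE_iff extensional_def)
next
  fix u assume u: "u \<in> weighted_tuples J (n - j)"
  have "(\<Sum>i\<in>J. i * (u(j := Suc (u j))) i) = n"
    using weighted_sum_remove[OF assms(1,2), of "u(j := Suc (u j))"] u assms(3)
    by (simp add: weighted_tuples_def)
  then show "u(j := Suc (u j)) \<in> {t \<in> weighted_tuples J n. t j > 0}"
    using u assms(2) by (auto simp: weighted_tuples_def PiE_iff extensional_def)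
qed auto

lemma tuple_sum_0:
  assumes "finite J" and "0 \<notin> J"
  shows "tuple_sum J b 0 = 1"
proof -
  have "weighted_tuples J 0 = {\<lambda>j. if j \<in> J then 0 else undefined}"
    using assms by (fastforce simp: weighted_tuples_def PiE_iff extensional_def)
  then show ?thesis
    by (simp add: tuple_sum_def tuple_term_def multinomial_def)
qed

text \<open>The Pascal rule distributes each tuple over its possible first parts \<open>j\<close>; collecting the
  shares by \<open>j\<close> instead of by tuple leaves, for each \<open>j\<close>, all tuples of weight \<open>n - j\<close>.\<close>

lemma tuple_sum_rec:
  assumes "finite J" and "0 \<notin> J" and "n > 0"
  shows "tuple_sum J b n = (\<Sum>j\<in>{j \<in> J. j \<le> n}. b j * tuple_sum J b (n - j))"
proof -
  have pos: "(\<Sum>i\<in>J. t i) > 0" if "t \<in> weighted_tuples J n" for t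
  proof (rule ccontr)
    assume "\<not> ?thesis"
    then have "\<forall>i\<in>J. t i = 0" using assms(1) by simp
    then show False using that assms(3) by (simp add: weighted_tuples_def)
  qed
  have le: "j \<le> n" if "t \<in> weighted_tuples J n" "j \<in> J" "t j > 0" for t j
    using weighted_sum_remove[where t = t, OF assms(1) that(2,3)] that(1)
    by (simp add: weighted_tuples_def)
  have "tuple_sum J b n = (\<Sum>t\<in>weighted_tuples J n.
      \<Sum>j\<in>{j \<in> J. t j > 0}. b j * tuple_term J b (t(j := t j - 1)))"
    unfolding tuple_sum_def
    by (intro sum.cong refl tuple_term_pascal[OF assms(1)] pos)
  also have "\<dots> = (\<Sum>t\<in>weighted_tuples J n.
      \<Sum>j\<in>{j \<in> {j \<in> J. j \<le> n}. t j > 0}. b j * tuple_term J b (t(j := t j - 1)))"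
    by (intro sum.cong refl) (auto dest: le)
  also have "\<dots> = (\<Sum>j\<in>{j \<in> J. j \<le> n}.
      \<Sum>t\<in>{t \<in> weighted_tuples J n. t j > 0}. b j * tuple_term J b (t(j := t j - 1)))"
    using assms(1,2) by (intro sum.swap_restrict finite_weighted_tuples) auto
  also have "\<dots> = (\<Sum>j\<in>{j \<in> J. j \<le> n}. b j * tuple_sum J b (n - j))"
    by (intro sum.cong refl)
      (simp add: sum_distrib_left[symmetric] tuple_sum_lower[OF assms(1)]
        del: fun_upd_apply One_nat_def)
  finally show ?thesis .
qed

section \<open>Coefficients of reciprocal power series\<close>

text \<open>Comparing coefficients in \<open>f * inverse f = 1\<close> gives the recurrence of
  \<open>tuple_sum_rec\<close>.  The coefficients of \<open>f\<close> are prescribed up to \<open>n\<close> only, so that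
  a finite \<open>J\<close> also serves for infinite series.\<close>

lemma fps_nth_inverse_tuple_sum:
  fixes f :: "rat fps"
  assumes "finite J" and "0 \<notin> J" and "fps_nth f 0 = 1"
    and "\<And>j. 0 < j \<Longrightarrow> j \<le> n \<Longrightarrow> fps_nth f j = (if j \<in> J then - b j else 0)"
  shows "fps_nth (inverse f) n = tuple_sum J b n"
  using assms(4)
proof (induction n rule: less_induct)
  case (less n)
  show ?case
  proof (cases "n = 0")
    case True
    then show ?thesis using assms by (simp add: tuple_sum_0)
  next
    case False
    have "f * inverse f = 1"
      using assms(3) by (simp add: inverse_mult_eq_1')
    then have "0 = fps_nth (f * inverse f) n"
      using False by simp
    also have "\<dots> = fps_nth (inverse f) n
        + (\<Sum>j=1..n. fps_nth f j * fps_nth (inverse f) (n - j))"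
      using assms(3) by (simp add: fps_mult_nth sum.atLeast_Suc_atMost)
    also have "(\<Sum>j=1..n. fps_nth f j * fps_nth (inverse f) (n - j))
        = (\<Sum>j\<in>{1..n}. if j \<in> J then - (b j * tuple_sum J b (n - j)) else 0)"
      using less by (intro sum.cong refl) auto
    also have "\<dots> = (\<Sum>j\<in>{1..n} \<inter> J. - (b j * tuple_sum J b (n - j)))"
      by (simp add: sum.inter_restrict)
    also have "{1..n} \<inter> J = {j \<in> J. j \<le> n}"
      using assms(2) by (auto simp: Suc_le_eq intro!: gr0I)
    finally show ?thesis
      using False by (simp add: tuple_sum_rec[OF assms(1,2)] sum_negf)
  qed
qed

definition signed_tuple_sum :: "nat set \<Rightarrow> (nat \<Rightarrow> rat) \<Rightarrow> nat \<Rightarrow> rat" where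
  "signed_tuple_sum J a n = (\<Sum>t\<in>weighted_tuples J n.
     multinomial J t * (- 1) ^ (\<Sum>j\<in>J. t j) * (\<Prod>j\<in>J. a j ^ t j))"

text \<open>The sign of a tuple is absorbed into the numbers \<open>a\<^sub>j\<close>, and so is a factor \<open>c\<^sup>j\<close>:
  the product of the \<open>c ^ (j * t\<^sub>j)\<close> is \<open>c\<^sup>n\<close> for every tuple of weight \<open>n\<close>.  With \<open>c = -1\<close>
  this accommodates the powers of \<open>-x\<close> in the Cauchy series.\<close>

lemma fps_nth_inverse_signed:
  fixes f :: "rat fps"
  assumes "finite J" and "0 \<notin> J" and "fps_nth f 0 = 1"
    and "\<And>j. 0 < j \<Longrightarrow> j \<le> n \<Longrightarrow> fps_nth f j = (if j \<in> J then c ^ j * a j else 0)"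
  shows "fps_nth (inverse f) n = c ^ n * signed_tuple_sum J a n"
proof -
  have "fps_nth (inverse f) n = tuple_sum J (\<lambda>j. c ^ j * (- 1 * a j)) n"
    using assms(4) by (intro fps_nth_inverse_tuple_sum assms(1-3)) simp
  also have "\<dots> = (\<Sum>t\<in>weighted_tuples J n. c ^ n * (multinomial J t *
      (- 1) ^ (\<Sum>j\<in>J. t j) * (\<Prod>j\<in>J. a j ^ t j)))"
    unfolding tuple_sum_def
  proof (intro sum.cong refl)
    fix t assume "t \<in> weighted_tuples J n"
    then have "(\<Prod>j\<in>J. c ^ (j * t j)) = c ^ n"
      by (auto simp: weighted_tuples_def simp flip: power_sum)
    then show "tuple_term J (\<lambda>j. c ^ j * (- 1 * a j)) t = c ^ n * (multinomial J t *
        (- 1) ^ (\<Sum>j\<in>J. t j) * (\<Prod>j\<in>J. a j ^ t j))"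
      unfolding tuple_term_def power_mult_distrib prod.distrib power_mult[symmetric]
      by (simp add: power_sum)
  qed
  finally show ?thesis
    by (simp add: signed_tuple_sum_def sum_distrib_left)
qed

lemma fps_nth_inverse_truncated:
  assumes "a 0 = 1" and "n \<ge> m"
  shows "fps_nth (inverse (\<Sum>k=0..m. fps_const (c ^ k * a k) * fps_X ^ k)) n
       = c ^ n * signed_tuple_sum {1..m} a n"
  using assms
  by (intro fps_nth_inverse_signed) (auto simp: fps_sum_nth fps_X_power_nth mult_delta_right)

lemma fps_nth_inverse_tail:
  assumes "m \<ge> 1"
  shows "fps_nth (inverse (1 + fps_from m (\<lambda>k. c ^ k * a k))) n
       = c ^ n * signed_tuple_sum {m..n} a n"
  using assms by (intro fps_nth_inverse_signed) (auto simp: fps_from_def)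

section \<open>Series in the square of the variable\<close>

lemma fps_nth_compose_X2: "fps_nth (g oo fps_X ^ 2) (2 * n) = fps_nth (g :: rat fps) n"
proof -
  have "(\<Sum>i=0..2 * n. fps_nth g i * (if n = i then 1 else 0)) = fps_nth g n"
    by (simp add: mult_delta_right)
  then show ?thesis
    by (simp add: fps_compose_nth fps_X_power_nth flip: power_mult)
qed

lemma fps_nth_inverse_compose_X2:
  fixes g :: "rat fps"
  assumes "fps_nth g 0 \<noteq> 0"
  shows "fps_nth (inverse (g oo fps_X ^ 2)) (2 * n) = fps_nth (inverse g) n"
  using assms by (simp add: fps_inverse_compose[symmetric] fps_nth_compose_X2)

lemma fps_nth_inverse_truncated_even:
  assumes "a 0 = 1" and "n \<ge> m"
  shows "fps_nth (inverse (\<Sum>k=0..m. fps_const (a k) * fps_X ^ (2 * k))) (2 * n)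
       = signed_tuple_sum {1..m} a n"
proof -
  let ?g = "\<Sum>k=0..m. fps_const (a k) * fps_X ^ k"
  have "(\<Sum>k=0..m. fps_const (a k) * fps_X ^ (2 * k)) = ?g oo fps_X ^ 2"
    by (simp add: fps_compose_sum_distrib fps_compose_mult_distrib fps_X_power_compose power_mult)
  moreover have "fps_nth ?g 0 = 1"
    using assms(1) by (simp add: fps_sum_nth fps_X_power_nth mult_delta_right)
  ultimately show ?thesis
    using fps_nth_inverse_truncated[where a = a and c = 1, OF assms]
    by (simp add: fps_nth_inverse_compose_X2)
qed

lemma fps_nth_inverse_tail_even:
  assumes "m \<ge> 1"
  shows "fps_nth (inverse (1 + (fps_from m a oo fps_X ^ 2))) (2 * n)
       = signed_tuple_sum {m..n} a n"
proof -
  let ?g = "1 + fps_from m a"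
  have "1 + (fps_from m a oo fps_X ^ 2) = ?g oo fps_X ^ 2"
    by (simp add: fps_compose_add_distrib)
  moreover have "fps_nth ?g 0 = 1"
    using assms by (simp add: fps_from_def)
  ultimately show ?thesis
    using fps_nth_inverse_tail[where a = a and c = 1, OF assms]
    by (simp add: fps_nth_inverse_compose_X2)
qed

section \<open>The four families\<close>

lemma inverse_pochhammer_eq:
  "1 / pochhammer (of_nat k + 1) j = (fact k / fact (k + j) :: rat)"
proof -
  have "(fact (k + j) :: rat) = fact k * pochhammer (of_nat k + 1) j"
    unfolding pochhammer_fact pochhammer_product' by (simp add: add.commute)
  then show ?thesis
    by simp
qed

lemma alpha_pochhammer:
  "alpha Bernoulli_Fam N = (\<lambda>j. 1 / pochhammer (of_nat N + 1) j)"
  "alpha Euler_Fam N = (\<lambda>j. 1 / pochhammer (2 * of_nat N + 1) (2 * j))"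
  "alpha Euler2_Fam N = (\<lambda>j. 1 / pochhammer (2 * of_nat N + 2) (2 * j))"
  using inverse_pochhammer_eq[of N] inverse_pochhammer_eq[of "2 * N"]
    inverse_pochhammer_eq[of "2 * N + 1"]
  by (auto simp: fun_eq_iff add.commute simp del: fact_Suc)

lemma alpha_0: "(F = Cauchy_Fam \<Longrightarrow> N \<ge> 1) \<Longrightarrow> alpha F N 0 = 1"
  by (cases F) auto

lemma cauchy_series:
  "of_nat N * (\<Sum>k=0..m. fps_const (1 / (of_nat N + of_nat k)) * (- fps_X) ^ k)
    = (\<Sum>k=0..m. fps_const ((- 1) ^ k * alpha Cauchy_Fam N k) * fps_X ^ k)"
  "of_nat N * fps_from m (\<lambda>k. (- 1) ^ k / (of_nat N + of_nat k))
    = fps_from m (\<lambda>k. (- 1) ^ k * alpha Cauchy_Fam N k)"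
proof -
  have scale: "of_nat N * f = fps_const (of_nat N) * f" for f :: "rat fps"
    by (simp add: fps_of_nat)
  have "(- fps_X) ^ k = fps_const ((- 1) ^ k) * (fps_X :: rat fps) ^ k" for k
    by (simp add: power_minus[of fps_X] flip: fps_const_power fps_const_neg)
  then show "of_nat N * (\<Sum>k=0..m. fps_const (1 / (of_nat N + of_nat k)) * (- fps_X) ^ k)
    = (\<Sum>k=0..m. fps_const ((- 1) ^ k * alpha Cauchy_Fam N k) * fps_X ^ k)"
    unfolding scale sum_distrib_left
    by (intro sum.cong refl) (simp flip: mult.assoc, simp add: mult.commute)
  show "of_nat N * fps_from m (\<lambda>k. (- 1) ^ k / (of_nat N + of_nat k))
    = fps_from m (\<lambda>k. (- 1) ^ k * alpha Cauchy_Fam N k)"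
    unfolding scale by (simp add: fps_eq_iff fps_from_def)
qed

theorem proposition8:
  fixes F :: family and N m n :: nat
  assumes "F = Bernoulli_Fam \<or> F = Cauchy_Fam \<Longrightarrow> N \<ge> 1"
    and "m \<ge> 1" and "n \<ge> m"
  shows "A_le F N m n = (- 1) ^ n * xi F n *
           (\<Sum>t\<in>weighted_tuples {1..m} n. multinomial {1..m} t *
              (- 1) ^ (\<Sum>j=1..m. t j) * (\<Prod>j=1..m. alpha F N j ^ t j))
       \<and> A_ge F N m n = (- 1) ^ n * xi F n *
           (\<Sum>t\<in>weighted_tuples {m..n} n. multinomial {m..n} t *
              (- 1) ^ (\<Sum>j=m..n. t j) * (\<Prod>j=m..n. alpha F N j ^ t j))"
  unfolding signed_tuple_sum_def[symmetric]
proof -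
  have sign: "(- 1) ^ n * ((- 1) ^ n * x) = (x :: rat)" for x
    by (simp flip: mult.assoc power_mult_distrib)
  note a0 = alpha_0[of F N]
  show "A_le F N m n = (- 1) ^ n * xi F n * signed_tuple_sum {1..m} (alpha F N) n
     \<and> A_ge F N m n = (- 1) ^ n * xi F n * signed_tuple_sum {m..n} (alpha F N) n"
  proof (cases F)
    case Bernoulli_Fam
    then show ?thesis
      using fps_nth_inverse_truncated[of "alpha F N" m n 1]
        fps_nth_inverse_tail[of m 1 "alpha F N" n] a0 assms
      by (simp add: bernoulli_le_def bernoulli_ge_def egf_coeff_def sign alpha_pochhammer
          del: alpha.simps)
  next
    case Cauchy_Fam
    then show ?thesis
      using fps_nth_inverse_truncated[of "alpha F N" m n "-1"]
        fps_nth_inverse_tail[of m "-1" "alpha F N" n] a0 assms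
      by (simp add: cauchy_le_def cauchy_ge_def cauchy_series egf_coeff_def
          del: alpha.simps)
  next
    case Euler_Fam
    then show ?thesis
      using fps_nth_inverse_truncated_even[of "alpha F N" m n]
        fps_nth_inverse_tail_even[of m "alpha F N" n] a0 assms
      by (simp add: euler_le_def euler_ge_def egf_coeff_def sign alpha_pochhammer
          del: alpha.simps)
  next
    case Euler2_Fam
    then show ?thesis
      using fps_nth_inverse_truncated_even[of "alpha F N" m n]
        fps_nth_inverse_tail_even[of m "alpha F N" n] a0 assms
      by (simp add: euler2_le_def euler2_ge_def egf_coeff_def sign alpha_pochhammer
          del: alpha.simps)
  qed
qed

end
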